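(* Let $q\geq 2$ and let $C$ be a completely regular code in $H(3,q)$ with covering radius $1$. Then $C$ fulfills the strong clique property if and only if $C$ is obtained by Construction D.
   Context: Let $\mathcal{A}$ be a set of size $q\geq 2$; $H(3,q)$ has vertex set $\mathcal{A}^3$, tuples adjacent iff they differ in exactly one position. A set $C$ of vertices is a completely regular code with covering radius $1$ if $C$ is a nonempty proper subset and there are integers $\beta,\gamma\geq1$ such that every vertex of $C$ has exactly $\beta$ neighbours outside $C$ and every vertex outside $C$ has exactly $\gamma$ neighbours in $C$. A maximum clique of codirection $i\in\{1,2,3\}$ in $H(3,q)$ is a set of $q$ tuples that agree in all positions except position $i$ and take all $q$ symbols in position $i$. $C$ fulfills the clique property if $C$ is a union of pairwise disjoint maximum cliques; it fulfills the strong clique property if moreover among these cliques there are cliques of each of the three codirections. For $X\subseteq\mathcal{A}$ write $\overline{X}=\mathcal{A}\setminus X$. Construction D: a set $C\subseteq\mathcal{A}^3$ is obtained by Construction D if there are nonempty proper subsets $R,S,T$ of $\mathcal{A}$, positive integers $a,b,c$, and sets $D^1\subseteq S\times T$, $D^2\subseteq R\times\overline{T}$, $D^3\subseteq\overline{R}\times\overline{S}$ such that: $|D^1\cap (S\times\{v\})|=a$ for all $v\in T$ and $|D^1\cap(\{u\}\times T)|=b$ for all $u\in S$; $|D^2\cap (R\times\{v\})|=a$ for all $v\in \overline T$ and $|D^2\cap(\{u\}\times \overline T)|=c$ for all $u\in R$; $|D^3\cap (\overline R\times\{v\})|=b$ for all $v\in \overline S$ and $|D^3\cap(\{u\}\times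 \overline S)|=c$ for all $u\in \overline R$; and $C=\{x: (x_2,x_3)\in D^1\}\cup\{x:(x_1,x_3)\in D^2\}\cup\{x:(x_1,x_2)\in D^3\}$. *)

theory Defs
  imports Main "HOL-Library.FuncSet" "HOL-Library.Disjoint_Sets"
begin

text \<open>The Hamming graph \<open>H(3,q)\<close> over an alphabet \<open>A\<close> with \<open>card A = q\<close>. A triple over \<open>A\<close> is an
  extensional function on the set \<open>{1, 2, 3}\<close> of positions.\<close>

definition positions :: "nat set" where
  "positions = {1, 2, 3}"

definition vertices :: "'a set \<Rightarrow> (nat \<Rightarrow> 'a) set" where
  "vertices A = positions \<rightarrow>\<^sub>E A"

definition adjacent :: "(nat \<Rightarrow> 'a) \<Rightarrow> (nat \<Rightarrow> 'a) \<Rightarrow> bool" where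
  "adjacent x y \<longleftrightarrow> card {i \<in> positions. x i \<noteq> y i} = 1"

definition completely_regular_radius_1 :: "'a set \<Rightarrow> (nat \<Rightarrow> 'a) set \<Rightarrow> bool" where
  "completely_regular_radius_1 A C \<longleftrightarrow>
     C \<noteq> {} \<and> C \<subset> vertices A \<and>
     (\<exists>\<beta> \<gamma> :: nat. \<beta> \<ge> 1 \<and> \<gamma> \<ge> 1 \<and>
        (\<forall>x \<in> C. card {y \<in> vertices A - C. adjacent x y} = \<beta>) \<and>
        (\<forall>x \<in> vertices A - C. card {y \<in> C. adjacent x y} = \<gamma>))"

definition max_clique :: "'a set \<Rightarrow> nat \<Rightarrow> (nat \<Rightarrow> 'a) set \<Rightarrow> bool" where
  "max_clique A i K \<longleftrightarrow>
     K \<subseteq> vertices A \<and> card K = card A \<and>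
     (\<forall>x \<in> K. \<forall>y \<in> K. \<forall>j \<in> positions - {i}. x j = y j) \<and>
     (\<lambda>x. x i) ` K = A"

definition clique_partition :: "'a set \<Rightarrow> (nat \<Rightarrow> 'a) set set \<Rightarrow> (nat \<Rightarrow> 'a) set \<Rightarrow> bool" where
  "clique_partition A \<K> C \<longleftrightarrow>
     (\<forall>K \<in> \<K>. \<exists>i \<in> positions. max_clique A i K) \<and> disjoint \<K> \<and> C = \<Union>\<K>"

definition clique_property :: "'a set \<Rightarrow> (nat \<Rightarrow> 'a) set \<Rightarrow> bool" where
  "clique_property A C \<longleftrightarrow> (\<exists>\<K>. clique_partition A \<K> C)"

definition strong_clique_property :: "'a set \<Rightarrow> (nat \<Rightarrow> 'a) set \<Rightarrow> bool" where
  "strong_clique_property A C \<longleftrightarrow>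
     (\<exists>\<K>. clique_partition A \<K> C \<and> (\<forall>i \<in> positions. \<exists>K \<in> \<K>. max_clique A i K))"

definition construction_D :: "'a set \<Rightarrow> (nat \<Rightarrow> 'a) set \<Rightarrow> bool" where
  "construction_D A C \<longleftrightarrow>
     (\<exists>R S T D1 D2 D3. \<exists>a b c :: nat.
        R \<noteq> {} \<and> R \<subset> A \<and> S \<noteq> {} \<and> S \<subset> A \<and> T \<noteq> {} \<and> T \<subset> A \<and>
        a > 0 \<and> b > 0 \<and> c > 0 \<and>
        D1 \<subseteq> S \<times> T \<and> D2 \<subseteq> R \<times> (A - T) \<and> D3 \<subseteq> (A - R) \<times> (A - S) \<and>
        (\<forall>v \<in> T. card (D1 \<inter> (S \<times> {v})) = a) \<and>
        (\<forall>u \<in> S. card (D1 \<inter> ({u} \<times> T)) = b) \<and>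
        (\<forall>v \<in> A - T. card (D2 \<inter> (R \<times> {v})) = a) \<and>
        (\<forall>u \<in> R. card (D2 \<inter> ({u} \<times> (A - T))) = c) \<and>
        (\<forall>v \<in> A - S. card (D3 \<inter> ((A - R) \<times> {v})) = b) \<and>
        (\<forall>u \<in> A - R. card (D3 \<inter> ({u} \<times> (A - S))) = c) \<and>
        C = {x \<in> vertices A. (x 2, x 3) \<in> D1}
            \<union> {x \<in> vertices A. (x 1, x 3) \<in> D2}
            \<union> {x \<in> vertices A. (x 1, x 2) \<in> D3})"

end

theory Submission
  imports Defs
begin

text \<open>
  For a partition of \<open>C\<close> into lines, count the neighbours outside \<open>C\<close> of the points of one line of
  codirection \<open>i\<close>. Moving along that line only changes coordinate \<open>i\<close>, so the constancy of the count
  says that the number of lines of the other two codirections having value \<open>t\<close> at position \<open>i\<close> does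
  not depend on \<open>t\<close>. Two lines of different codirections \<open>j\<close> and \<open>k\<close> with the same value at the
  third position \<open>i\<close> always meet, so for each \<open>t\<close> only one of the two codirections contributes to
  that number; this splits the alphabet at position \<open>i\<close> in two parts, giving \<open>R\<close>, \<open>S\<close>, \<open>T\<close>.
\<close>

section \<open>Lines and coordinates of triples\<close>

text \<open>The base point fixes the line through its other two coordinates only. Thus a single
  vertex serves as base point for all three lines through it.\<close>

definition line :: "'a set \<Rightarrow> nat \<Rightarrow> (nat \<Rightarrow> 'a) \<Rightarrow> (nat \<Rightarrow> 'a) set" where
  "line A i x = (\<lambda>t. x(i := t)) ` A"

text \<open>The value \<open>undefined\<close> off the positions is what extensionality in
  \<open>vertices\<close> demands, so every vertex has this form.\<close>

definition triple :: "'a \<Rightarrow> 'a \<Rightarrow> 'a \<Rightarrow> nat \<Rightarrow> 'a" where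
  "triple a b c = (\<lambda>_. undefined)(1 := a, 2 := b, 3 := c)"

lemma triple_nth [simp]:
  "triple a b c 1 = a" "triple a b c (Suc 0) = a" "triple a b c 2 = b" "triple a b c 3 = c"
  by (simp_all add: triple_def)

lemma triple_upd [simp]:
  "(triple a b c)(1 := t) = triple t b c" "(triple a b c)(Suc 0 := t) = triple t b c"
  "(triple a b c)(2 := t) = triple a t c"
  "(triple a b c)(3 := t) = triple a b t"
  by (auto simp: triple_def fun_eq_iff)

lemma triple_in_vertices [simp]:
  "triple a b c \<in> vertices A \<longleftrightarrow> a \<in> A \<and> b \<in> A \<and> c \<in> A"
  by (auto simp: triple_def vertices_def positions_def PiE_iff extensional_def)

lemma vertices_triple:
  assumes "x \<in> vertices A"
  shows "x = triple (x 1) (x 2) (x 3)"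
  using assms
  by (auto simp: triple_def vertices_def positions_def PiE_iff extensional_def fun_eq_iff)

lemma vertices_nth: "x \<in> vertices A \<Longrightarrow> i \<in> positions \<Longrightarrow> x i \<in> A"
  by (auto simp: vertices_def)

lemma vertices_upd:
  "x \<in> vertices A \<Longrightarrow> i \<in> positions \<Longrightarrow> t \<in> A \<Longrightarrow> x(i := t) \<in> vertices A"
  by (auto simp: vertices_def PiE_iff extensional_def)

lemma vertices_eqI:
  assumes "x \<in> vertices A" "y \<in> vertices A" "\<And>j. j \<in> positions \<Longrightarrow> x j = y j"
  shows "x = y"
  using assms unfolding vertices_def by (rule PiE_ext)

lemma line_upd [simp]: "line A i (x(i := t)) = line A i x"
  by (simp add: line_def)

lemma in_line_self: "x \<in> vertices A \<Longrightarrow> i \<in> positions \<Longrightarrow> x \<in> line A i x"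
  unfolding line_def by (rule image_eqI[where x = "x i"]) (auto simp: vertices_nth)

lemma line_eq: "y \<in> line A i x \<Longrightarrow> line A i y = line A i x"
  by (auto simp: line_def)

lemma line_subset_vertices:
  "x \<in> vertices A \<Longrightarrow> i \<in> positions \<Longrightarrow> line A i x \<subseteq> vertices A"
  by (auto simp: line_def vertices_upd)

lemma max_clique_line:
  assumes "x \<in> vertices A" "i \<in> positions"
  shows "max_clique A i (line A i x)"
proof -
  have "inj_on (\<lambda>t. x(i := t)) A"
    by (rule inj_onI) (metis fun_upd_same)
  then show ?thesis
    using line_subset_vertices[OF assms]
    by (auto simp: max_clique_def line_def card_image image_image)
qed

text \<open>Members of K differ from x at most in position i, so each is \<open>x(i := y i)\<close>;
  and position i takes every symbol of A on K.\<close>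

lemma max_clique_eq_line:
  assumes K: "max_clique A i K" and x: "x \<in> K" and i: "i \<in> positions"
  shows "K = line A i x"
proof
  have KV: "K \<subseteq> vertices A" and im: "(\<lambda>y. y i) ` K = A"
    and agree: "\<And>y j. y \<in> K \<Longrightarrow> j \<in> positions - {i} \<Longrightarrow> x j = y j"
    using K x by (auto simp: max_clique_def)
  have upd: "y = x(i := y i)" if "y \<in> K" for y
  proof (rule vertices_eqI)
    show "y \<in> vertices A" "x(i := y i) \<in> vertices A"
      using that KV x vertices_upd[OF _ i vertices_nth[OF _ i]] by blast+
    show "y j = (x(i := y i)) j" if "j \<in> positions" for j
      using agree[OF \<open>y \<in> K\<close>] that by auto
  qed
  then show "K \<subseteq> line A i x"
    using im unfolding line_def by blast
  show "line A i x \<subseteq> K"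
    using im upd by (fastforce simp: line_def)
qed

text \<open>Position i runs through all of A on a line of codirection i but is constant on a line of
  any other codirection; two symbols suffice to tell these apart.\<close>

lemma line_codirection_unique:
  assumes "card A \<ge> 2" "x \<in> vertices A" "i \<in> positions" "j \<in> positions"
    "line A i x = line A j x"
  shows "i = j"
proof (rule ccontr)
  assume "i \<noteq> j"
  then have "(\<lambda>y. y i) ` line A j x \<subseteq> {x i}"
    by (auto simp: line_def)
  moreover have "(\<lambda>y. y i) ` line A i x = A"
    by (auto simp: line_def image_image)
  ultimately have "A \<subseteq> {x i}"
    using assms(5) by simp
  then have "card A \<le> 1"
    using card_mono[of "{x i}" A] by simp
  then show False
    using assms(1) by simp
qed

section \<open>From Construction D to a partition into lines\<close>

text \<open>Read \<open>E i x\<close> as: the line of codirection i through x is selected. By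
  \<open>inv\<close> this is a property of the line, and by \<open>uniq\<close> a common point of
  two selected lines forces equal codirections, hence equal lines.\<close>

lemma clique_partition_lines:
  assumes inv: "\<And>i x t. E i (x(i := t)) = E i x"
    and uniq: "\<And>x i j. x \<in> vertices A \<Longrightarrow> i \<in> positions \<Longrightarrow> j \<in> positions \<Longrightarrow> E i x \<Longrightarrow> E j x \<Longrightarrow> i = j"
  shows "clique_partition A {line A i x | i x. i \<in> positions \<and> x \<in> vertices A \<and> E i x}
           {x \<in> vertices A. \<exists>i \<in> positions. E i x}"
proof -
  let ?K = "{line A i x | i x. i \<in> positions \<and> x \<in> vertices A \<and> E i x}"
  have E_line: "E i y" if "E i x" "y \<in> line A i x" for i x y
    using that inv by (auto simp: line_def)
  have "L = M" if "L \<in> ?K" "M \<in> ?K" "y \<in> L" "y \<in> M" for L M y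
  proof -
    obtain i x where L: "L = line A i x" "i \<in> positions" "x \<in> vertices A" "E i x"
      using \<open>L \<in> ?K\<close> by blast
    obtain j z where M: "M = line A j z" "j \<in> positions" "z \<in> vertices A" "E j z"
      using \<open>M \<in> ?K\<close> by blast
    have "E i y" "E j y"
      using L M that E_line by blast+
    moreover have "y \<in> vertices A"
      using L that line_subset_vertices by blast
    ultimately have "i = j"
      using uniq L M by blast
    then show ?thesis
      using L M that line_eq by metis
  qed
  then have "disjoint ?K"
    unfolding disjoint_def by blast
  moreover have "\<forall>L \<in> ?K. \<exists>i \<in> positions. max_clique A i L"
    using max_clique_line by blast
  moreover have "{x \<in> vertices A. \<exists>i \<in> positions. E i x} = \<Union> ?K"
  proof (intro equalityI subsetI)
    fix y assume "y \<in> \<Union> ?K"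
    then obtain i x where "i \<in> positions" "x \<in> vertices A" "E i x" "y \<in> line A i x"
      by blast
    then show "y \<in> {x \<in> vertices A. \<exists>i \<in> positions. E i x}"
      using line_subset_vertices[of x A i] E_line[of i x y] by blast
  qed (use in_line_self in fastforce)
  ultimately show ?thesis
    unfolding clique_partition_def by blast
qed

lemma construction_D_imp_strong_clique_property:
  assumes "construction_D A C"
  shows "strong_clique_property A C"
proof -
  obtain R S T D1 D2 D3 and a b c :: nat where
    ne: "S \<noteq> {}" "R \<noteq> {}" "R \<subset> A"
    and sub: "S \<subset> A" "T \<subset> A" "D1 \<subseteq> S \<times> T" "D2 \<subseteq> R \<times> (A - T)" "D3 \<subseteq> (A - R) \<times> (A - S)"
    and pos: "b > 0" "c > 0"
    and d1: "\<forall>u \<in> S. card (D1 \<inter> ({u} \<times> T)) = b"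
    and d2: "\<forall>u \<in> R. card (D2 \<inter> ({u} \<times> (A - T))) = c"
    and d3: "\<forall>u \<in> A - R. card (D3 \<inter> ({u} \<times> (A - S))) = c"
    and C: "C = {x \<in> vertices A. (x 2, x 3) \<in> D1}
            \<union> {x \<in> vertices A. (x 1, x 3) \<in> D2}
            \<union> {x \<in> vertices A. (x 1, x 2) \<in> D3}"
    using assms unfolding construction_D_def by (elim exE conjE) (rule that; assumption)
  define E where "E i x \<longleftrightarrow> (if i = 1 then (x 2, x 3) \<in> D1
      else if i = 2 then (x 1, x 3) \<in> D2 else i = 3 \<and> (x 1, x 2) \<in> D3)"
    for i :: nat and x :: "nat \<Rightarrow> 'a"
  let ?K = "{line A i x | i x. i \<in> positions \<and> x \<in> vertices A \<and> E i x}"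
  have part: "clique_partition A ?K C"
  proof -
    have "C = {x \<in> vertices A. \<exists>i \<in> positions. E i x}"
      by (auto simp: C E_def positions_def)
    moreover have "E i (x(i := t)) = E i x" for i x t
      by (simp add: E_def)
    \<comment> \<open>Position 3 separates codirections 1 and 2 (T against its complement), position
      2 separates 1 and 3 (S), and position 1 separates 2 and 3 (R).\<close>
    moreover have "i = j" if "i \<in> positions" "j \<in> positions" "E i x" "E j x" for x i j
      using that sub by (auto simp: E_def positions_def split: if_splits)
    ultimately show ?thesis
      using clique_partition_lines[of E A] by presburger
  qed
  have nonempty: "D1 \<noteq> {}" "D2 \<noteq> {}" "D3 \<noteq> {}"
    using ne pos d1 d2 d3 by fastforce+
  have "\<exists>x \<in> vertices A. E i x" if "i \<in> positions" for i
  proof -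
    obtain u1 v1 u2 v2 u3 v3 where uv: "(u1, v1) \<in> D1" "(u2, v2) \<in> D2" "(u3, v3) \<in> D3"
      using nonempty by fastforce
    \<comment> \<open>The coordinate in the direction of the line is free; repeating a known entry
      keeps it in A.\<close>
    then have "triple u1 u1 v1 \<in> vertices A" "triple u2 u2 v2 \<in> vertices A"
      "triple u3 v3 v3 \<in> vertices A"
      using sub ne by auto
    moreover have "E 1 (triple u1 u1 v1)" "E 2 (triple u2 u2 v2)" "E 3 (triple u3 v3 v3)"
      using uv by (simp_all add: E_def)
    ultimately show ?thesis
      using that by (auto simp: positions_def)
  qed
  then have "\<forall>i \<in> positions. \<exists>K \<in> ?K. max_clique A i K"
    by (fastforce intro: max_clique_line)
  with part have "clique_partition A ?K C \<and> (\<forall>i \<in> positions. \<exists>K \<in> ?K. max_clique A i K)"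
    by (rule conjI)
  then show ?thesis
    unfolding strong_clique_property_def by (rule exI)
qed

section \<open>Counting neighbours outside the code\<close>

text \<open>A neighbour of x is \<open>x(i := t)\<close> for exactly one position i. The trivial
  change t = \<open>x i\<close> gives x itself, which lies in C, so it is never counted.\<close>

lemma card_outer_neighbours:
  assumes "finite A" "x \<in> C" "x \<in> vertices A"
  shows "card {y \<in> vertices A - C. adjacent x y} = (\<Sum>i \<in> positions. card {t \<in> A. x(i := t) \<notin> C})"
proof -
  let ?B = "\<lambda>i. {t \<in> A. x(i := t) \<notin> C}"
  have ne: "x i \<noteq> t" if "t \<in> ?B i" for i t
    using that assms(2) fun_upd_triv[of x i] by auto
  have "{y \<in> vertices A - C. adjacent x y} = (\<Union>i \<in> positions. (\<lambda>t. x(i := t)) ` ?B i)"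
  proof (intro equalityI subsetI)
    fix y assume "y \<in> {y \<in> vertices A - C. adjacent x y}"
    then have y: "y \<in> vertices A" "y \<notin> C" "card {i \<in> positions. x i \<noteq> y i} = 1"
      by (auto simp: adjacent_def)
    then obtain i where i: "{i \<in> positions. x i \<noteq> y i} = {i}"
      using card_1_singletonE by blast
    then have pos: "i \<in> positions"
      by blast
    have "x j = y j" if "j \<in> positions" "j \<noteq> i" for j
      using i that by blast
    then have "y = x(i := y i)"
      using y assms(3) pos by (intro vertices_eqI[of _ A]) (auto simp: vertices_upd vertices_nth)
    then show "y \<in> (\<Union>i \<in> positions. (\<lambda>t. x(i := t)) ` ?B i)"
      using y pos vertices_nth by fastforce
  next
    fix y assume "y \<in> (\<Union>i \<in> positions. (\<lambda>t. x(i := t)) ` ?B i)"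
    then obtain i t where it: "i \<in> positions" "t \<in> ?B i" "y = x(i := t)"
      by blast
    then have "{j \<in> positions. x j \<noteq> y j} = {i}"
      using ne by auto
    then show "y \<in> {y \<in> vertices A - C. adjacent x y}"
      using it assms(3) by (simp add: adjacent_def vertices_upd)
  qed
  moreover have "card (\<Union>i \<in> positions. (\<lambda>t. x(i := t)) ` ?B i)
      = (\<Sum>i \<in> positions. card ((\<lambda>t. x(i := t)) ` ?B i))"
  proof (rule card_UN_disjoint)
    show "\<forall>i \<in> positions. \<forall>j \<in> positions. i \<noteq> j \<longrightarrow>
        (\<lambda>t. x(i := t)) ` ?B i \<inter> (\<lambda>t. x(j := t)) ` ?B j = {}"
    proof (intro ballI impI)
      fix i j :: nat assume "i \<noteq> j"
      have False if "s \<in> ?B i" "t \<in> ?B j" "x(i := s) = x(j := t)" for s t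
        using fun_cong[OF that(3), of i] ne[OF that(1)] \<open>i \<noteq> j\<close> by simp
      then show "(\<lambda>t. x(i := t)) ` ?B i \<inter> (\<lambda>t. x(j := t)) ` ?B j = {}"
        by blast
    qed
  qed (use assms(1) in \<open>auto simp: positions_def\<close>)
  moreover have "card ((\<lambda>t. x(i := t)) ` ?B i) = card (?B i)" for i
    by (intro card_image inj_onI) (metis fun_upd_same)
  ultimately show ?thesis
    by simp
qed

text \<open>One codirection of the counting argument: \<open>g1 b c\<close>, \<open>g2 a c\<close>, \<open>g3 a b\<close> say that the line
  through \<open>(a, b, c)\<close> of codirection 1, 2, 3 belongs to the partition.\<close>

lemma degree_sum_constant:
  fixes g1 g2 g3 :: "'a \<Rightarrow> 'a \<Rightarrow> bool"
  assumes fin: "finite A"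
    and reg: "\<And>a. a \<in> A \<Longrightarrow>
      card {t \<in> A. \<not> (g1 b c \<or> g2 t c \<or> g3 t b)} +
      (card {t \<in> A. \<not> (g1 t c \<or> g2 a c \<or> g3 a t)} +
       card {t \<in> A. \<not> (g1 b t \<or> g2 a t \<or> g3 a b)}) = \<beta>"
    and d12: "\<And>a b c. a \<in> A \<Longrightarrow> b \<in> A \<Longrightarrow> c \<in> A \<Longrightarrow> g1 b c \<Longrightarrow> \<not> g2 a c"
    and d13: "\<And>a b c. a \<in> A \<Longrightarrow> b \<in> A \<Longrightarrow> c \<in> A \<Longrightarrow> g1 b c \<Longrightarrow> \<not> g3 a b"
    and bc: "b \<in> A" "c \<in> A" "g1 b c"
  shows "\<exists>k. \<forall>a \<in> A. card {t \<in> A. g2 a t} + card {t \<in> A. g3 a t} = k"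
proof -
  have split: "card {t \<in> A. \<not> (P t \<or> Q t)} + card {t \<in> A. P t} + card {t \<in> A. Q t} = card A"
    if "\<And>t. t \<in> A \<Longrightarrow> P t \<Longrightarrow> \<not> Q t" for P Q
  proof -
    have "card A = card ({t \<in> A. \<not> (P t \<or> Q t)} \<union> ({t \<in> A. P t} \<union> {t \<in> A. Q t}))"
      by (rule arg_cong[where f = card]) blast
    also have "\<dots> = card {t \<in> A. \<not> (P t \<or> Q t)} + card ({t \<in> A. P t} \<union> {t \<in> A. Q t})"
      by (rule card_Un_disjoint) (use fin in auto)
    also have "card ({t \<in> A. P t} \<union> {t \<in> A. Q t}) = card {t \<in> A. P t} + card {t \<in> A. Q t}"
      by (rule card_Un_disjoint) (use fin that in auto)
    finally show ?thesis by simp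
  qed
  \<comment> \<open>The right-hand side is free of a and serves as k. No subtraction truncates: the
    equations below write \<open>2 * card A\<close> as the sum of all the other terms.\<close>
  have "card {t \<in> A. g2 a t} + card {t \<in> A. g3 a t}
      = 2 * card A - \<beta> - card {t \<in> A. g1 t c} - card {t \<in> A. g1 b t}" if a: "a \<in> A" for a
  proof -
    have "\<not> g2 a c" "\<not> g3 a b"
      using d12 d13 bc a by blast+
    \<comment> \<open>Since \<open>g1 b c\<close> holds, the first summand of \<open>reg\<close>
      counts the empty set, and the two exclusions remove \<open>g2 a c\<close> and
      \<open>g3 a b\<close> from the others.\<close>
    then have "card {t \<in> A. \<not> (g1 t c \<or> g3 a t)} + card {t \<in> A. \<not> (g1 b t \<or> g2 a t)} = \<beta>"
      using reg[OF a] bc by simp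
    moreover have "card {t \<in> A. \<not> (g1 t c \<or> g3 a t)} + card {t \<in> A. g1 t c}
        + card {t \<in> A. g3 a t} = card A"
      using d13 bc a by (intro split) blast
    moreover have "card {t \<in> A. \<not> (g1 b t \<or> g2 a t)} + card {t \<in> A. g1 b t}
        + card {t \<in> A. g2 a t} = card A"
      using d12 bc a by (intro split) blast
    ultimately show ?thesis
      by linarith
  qed
  then show ?thesis
    by blast
qed

section \<open>From a partition into lines to Construction D\<close>

lemma strong_clique_property_imp_construction_D:
  assumes q: "card A \<ge> 2" and cr: "completely_regular_radius_1 A C"
    and "strong_clique_property A C"
  shows "construction_D A C"
proof -
  have fin: "finite A"
    using q card.infinite by fastforce
  obtain \<K> where "clique_partition A \<K> C"
    and dirs: "\<forall>i \<in> positions. \<exists>K \<in> \<K>. max_clique A i K"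
    using assms(3) by (auto simp: strong_clique_property_def)
  then have max: "\<forall>K \<in> \<K>. \<exists>i \<in> positions. max_clique A i K" and disj: "disjoint \<K>"
    and C: "C = \<Union> \<K>"
    by (auto simp: clique_partition_def)
  have CV: "C \<subseteq> vertices A"
    using cr by (auto simp: completely_regular_radius_1_def)
  obtain \<beta> where \<beta>: "\<forall>x \<in> C. card {y \<in> vertices A - C. adjacent x y} = \<beta>"
    using cr by (auto simp: completely_regular_radius_1_def)
  have in_C: "x \<in> C \<longleftrightarrow> (\<exists>i \<in> positions. line A i x \<in> \<K>)" if "x \<in> vertices A" for x
  proof
    assume "x \<in> C"
    then show "\<exists>i \<in> positions. line A i x \<in> \<K>"
      using C max max_clique_eq_line by fastforce
  next
    assume "\<exists>i \<in> positions. line A i x \<in> \<K>"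
    then show "x \<in> C"
      using C in_line_self[OF that] by blast
  qed
  have uniq: "i = j" if "x \<in> vertices A" "i \<in> positions" "j \<in> positions"
    "line A i x \<in> \<K>" "line A j x \<in> \<K>" for i j x
  proof -
    have "line A i x = line A j x"
      using disj that in_line_self[OF that(1)] unfolding disjoint_def by blast
    then show ?thesis
      using line_codirection_unique q that by blast
  qed
  have dir: "\<exists>x \<in> vertices A. line A i x \<in> \<K>" if i: "i \<in> positions" for i
  proof -
    obtain K where K: "K \<in> \<K>" "max_clique A i K"
      using dirs i by blast
    then have "K \<noteq> {}" "K \<subseteq> vertices A"
      using q by (auto simp: max_clique_def)
    then show ?thesis
      using K i max_clique_eq_line by fastforce
  qed
  text \<open>A line of codirection \<open>i\<close> does not depend on the \<open>i\<close>-th coordinate of the base point.\<close>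
  define g1 where "g1 b c \<longleftrightarrow> line A 1 (triple undefined b c) \<in> \<K>" for b c
  define g2 where "g2 a c \<longleftrightarrow> line A 2 (triple a undefined c) \<in> \<K>" for a c
  define g3 where "g3 a b \<longleftrightarrow> line A 3 (triple a b undefined) \<in> \<K>" for a b
  have g1: "line A 1 (triple a b c) \<in> \<K> \<longleftrightarrow> g1 b c" for a b c
    unfolding g1_def by (metis line_upd triple_upd(1))
  have g2: "line A 2 (triple a b c) \<in> \<K> \<longleftrightarrow> g2 a c" for a b c
    unfolding g2_def by (metis line_upd triple_upd(3))
  have g3: "line A 3 (triple a b c) \<in> \<K> \<longleftrightarrow> g3 a b" for a b c
    unfolding g3_def by (metis line_upd triple_upd(4))
  have F: "triple a b c \<in> C \<longleftrightarrow> g1 b c \<or> g2 a c \<or> g3 a b" if "a \<in> A" "b \<in> A" "c \<in> A" for a b c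
    using in_C[of "triple a b c"] that g1[of a b c] g2[of a b c] g3[of a b c]
    by (simp add: positions_def)
  \<comment> \<open>Both lines in each case pass through \<open>triple a b c\<close>, where
    \<open>uniq\<close> admits only one line of the partition.\<close>
  have d12: "\<not> (g1 b c \<and> g2 a c)" and d13: "\<not> (g1 b c \<and> g3 a b)" and d23: "\<not> (g2 a c \<and> g3 a b)"
    if "a \<in> A" "b \<in> A" "c \<in> A" for a b c
    using that uniq[of "triple a b c" 1 2] uniq[of "triple a b c" 1 3] uniq[of "triple a b c" 2 3]
      g1[of a b c] g2[of a b c] g3[of a b c]
    by (auto simp: positions_def)
  have reg: "card {t \<in> A. \<not> (g1 b c \<or> g2 t c \<or> g3 t b)} +
      (card {t \<in> A. \<not> (g1 t c \<or> g2 a c \<or> g3 a t)} +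
       card {t \<in> A. \<not> (g1 b t \<or> g2 a t \<or> g3 a b)}) = \<beta>"
    if A: "a \<in> A" "b \<in> A" "c \<in> A" and g: "g1 b c \<or> g2 a c \<or> g3 a b" for a b c
  proof -
    have "(\<Sum>i \<in> positions. card {t \<in> A. (triple a b c)(i := t) \<notin> C}) = \<beta>"
      using card_outer_neighbours[OF fin, of "triple a b c" C] \<beta> F[OF A] A g by simp
    moreover have "{t \<in> A. triple t b c \<notin> C} = {t \<in> A. \<not> (g1 b c \<or> g2 t c \<or> g3 t b)}"
      "{t \<in> A. triple a t c \<notin> C} = {t \<in> A. \<not> (g1 t c \<or> g2 a c \<or> g3 a t)}"
      "{t \<in> A. triple a b t \<notin> C} = {t \<in> A. \<not> (g1 b t \<or> g2 a t \<or> g3 a b)}"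
      using A F by blast+
    ultimately show ?thesis
      by (simp add: positions_def)
  qed
  have ex: "\<exists>b \<in> A. \<exists>c \<in> A. g1 b c" "\<exists>a \<in> A. \<exists>c \<in> A. g2 a c" "\<exists>a \<in> A. \<exists>b \<in> A. g3 a b"
    using dir[of 1] dir[of 2] dir[of 3] g1 g2 g3 vertices_triple vertices_nth
    by (metis insertCI positions_def)+
  obtain b1 c1 a2 c2 a3 b3 where w: "b1 \<in> A" "c1 \<in> A" "g1 b1 c1" "a2 \<in> A" "c2 \<in> A" "g2 a2 c2"
    "a3 \<in> A" "b3 \<in> A" "g3 a3 b3"
    using ex by blast
  \<comment> \<open>Moving along the line of codirection 1 at \<open>b1\<close>, \<open>c1\<close>
    varies the first coordinate; the constant found is the c of Construction D.\<close>
  have "\<exists>k. \<forall>u \<in> A. card {t \<in> A. g2 u t} + card {t \<in> A. g3 u t} = k"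
  proof (rule degree_sum_constant[of A g1 b1 c1 g2 g3 \<beta>, OF fin _ _ _ w(1-3)])
    show "card {t \<in> A. \<not> (g1 b1 c1 \<or> g2 t c1 \<or> g3 t b1)} +
        (card {t \<in> A. \<not> (g1 t c1 \<or> g2 u c1 \<or> g3 u t)} +
         card {t \<in> A. \<not> (g1 b1 t \<or> g2 u t \<or> g3 u b1)}) = \<beta>" if "u \<in> A" for u
      using reg that w by blast
  qed (use d12 d13 in blast)+
  then obtain c where c: "\<forall>u \<in> A. card {t \<in> A. g2 u t} + card {t \<in> A. g3 u t} = c"
    by (rule exE)
  \<comment> \<open>Now the second coordinate moves. \<open>degree_sum_constant\<close> expects the
    moving coordinate as first argument, so \<open>g3\<close> enters transposed.\<close>
  have "\<exists>k. \<forall>u \<in> A. card {t \<in> A. g1 u t} + card {t \<in> A. g3 t u} = k"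
  proof (rule degree_sum_constant[of A g2 a2 c2 g1 "\<lambda>u v. g3 v u" \<beta>, OF fin _ _ _ w(4-6)])
    show "card {t \<in> A. \<not> (g2 a2 c2 \<or> g1 t c2 \<or> g3 a2 t)} +
        (card {t \<in> A. \<not> (g2 t c2 \<or> g1 u c2 \<or> g3 t u)} +
         card {t \<in> A. \<not> (g2 a2 t \<or> g1 u t \<or> g3 a2 u)}) = \<beta>" if "u \<in> A" for u
      using reg[of a2 u c2] that w by (simp only: simp_thms ac_simps disj_ac)
  qed (use d12 d23 in blast)+
  then obtain b where b: "\<forall>u \<in> A. card {t \<in> A. g1 u t} + card {t \<in> A. g3 t u} = b"
    by (rule exE)
  \<comment> \<open>The third coordinate is the second argument of both \<open>g1\<close> and
    \<open>g2\<close>, so both are transposed.\<close>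
  have "\<exists>k. \<forall>u \<in> A. card {t \<in> A. g1 t u} + card {t \<in> A. g2 t u} = k"
  proof (rule degree_sum_constant[of A g3 a3 b3 "\<lambda>u v. g1 v u" "\<lambda>u v. g2 v u" \<beta>, OF fin _ _ _ w(7-9)])
    show "card {t \<in> A. \<not> (g3 a3 b3 \<or> g1 b3 t \<or> g2 a3 t)} +
        (card {t \<in> A. \<not> (g3 t b3 \<or> g1 b3 u \<or> g2 t u)} +
         card {t \<in> A. \<not> (g3 a3 t \<or> g1 t u \<or> g2 a3 u)}) = \<beta>" if "u \<in> A" for u
      using reg[of a3 b3 u] that w by (simp only: simp_thms ac_simps disj_ac)
  qed (use d13 d23 in blast)+
  then obtain a where a: "\<forall>u \<in> A. card {t \<in> A. g1 t u} + card {t \<in> A. g2 t u} = a"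
    by (rule exE)
  \<comment> \<open>At each position one of the two contributing codirections defines the set; the
    exclusions confine the other codirection to the complement.\<close>
  define R where "R = {u \<in> A. \<exists>v \<in> A. g2 u v}"
  define S where "S = {u \<in> A. \<exists>v \<in> A. g1 u v}"
  define T where "T = {v \<in> A. \<exists>u \<in> A. g1 u v}"
  define D1 where "D1 = {(u, v) \<in> A \<times> A. g1 u v}"
  define D2 where "D2 = {(u, v) \<in> A \<times> A. g2 u v}"
  define D3 where "D3 = {(u, v) \<in> A \<times> A. g3 u v}"
  have sub: "R \<subseteq> A" "S \<subseteq> A" "T \<subseteq> A"
    by (auto simp: R_def S_def T_def)
  have D1_sub: "D1 \<subseteq> S \<times> T"
    by (auto simp: D1_def S_def T_def)
  have D2_sub: "D2 \<subseteq> R \<times> (A - T)"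
    using d12 by (auto simp: D2_def R_def T_def)
  have D3_sub: "D3 \<subseteq> (A - R) \<times> (A - S)"
    using d13 d23 by (auto simp: D3_def R_def S_def)
  \<comment> \<open>Intersecting with Y loses nothing, because all second entries of D already lie
    in Y.\<close>
  have row: "card (D \<inter> ({u} \<times> Y)) = card {t \<in> A. g u t}"
    if "D = {(u, v) \<in> A \<times> A. g u v}" "D \<subseteq> X \<times> Y" "u \<in> A" for D X Y u g
  proof -
    have "D \<inter> ({u} \<times> Y) = Pair u ` {t \<in> A. g u t}"
      using that by blast
    then show ?thesis
      by (simp add: card_image inj_on_def)
  qed
  have col: "card (D \<inter> (X \<times> {v})) = card {t \<in> A. g t v}"
    if "D = {(u, v) \<in> A \<times> A. g u v}" "D \<subseteq> X \<times> Y" "v \<in> A" for D X Y v g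
  proof -
    have "D \<inter> (X \<times> {v}) = (\<lambda>u. (u, v)) ` {t \<in> A. g t v}"
      using that by blast
    then show ?thesis
      by (simp add: card_image inj_on_def)
  qed
  have C_eq: "C = {x \<in> vertices A. (x 2, x 3) \<in> D1}
            \<union> {x \<in> vertices A. (x 1, x 3) \<in> D2}
            \<union> {x \<in> vertices A. (x 1, x 2) \<in> D3}"
  proof -
    have "x \<in> C \<longleftrightarrow> (x 2, x 3) \<in> D1 \<or> (x 1, x 3) \<in> D2 \<or> (x 1, x 2) \<in> D3" if x: "x \<in> vertices A" for x
    proof -
      have xA: "x 1 \<in> A" "x 2 \<in> A" "x 3 \<in> A"
        using x vertices_nth by (auto simp: positions_def)
      then show ?thesis
        using F[OF xA] vertices_triple[OF x] by (simp add: D1_def D2_def D3_def)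
    qed
    then show ?thesis
      using CV by blast
  qed
  have zero: "card {t \<in> A. P t} = 0" if "\<And>t. t \<in> A \<Longrightarrow> \<not> P t" for P
  proof -
    have "{t \<in> A. P t} = {}"
      using that by blast
    then show ?thesis
      by (simp only: card.empty)
  qed
  have pos: "card {t \<in> A. P t} > 0" if "s \<in> A" "P s" for s P
    using that fin by (auto simp: card_gt_0_iff)
  \<comment> \<open>In each constant sum one summand vanishes: by exclusion inside T, S or R, and by
    definition of these sets outside. The surviving summand is the whole constant.\<close>
  have "card {t \<in> A. g2 t v} = 0" if "v \<in> T" for v
    by (rule zero) (use that d12 in \<open>auto simp: T_def\<close>)
  then have T1: "card {t \<in> A. g1 t v} = a" if "v \<in> T" for v
    using a sub that by fastforce
  have "card {t \<in> A. g1 t v} = 0" if "v \<in> A - T" for v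
    by (rule zero) (use that in \<open>auto simp: T_def\<close>)
  then have T2: "card {t \<in> A. g2 t v} = a" if "v \<in> A - T" for v
    using a sub that by fastforce
  have "card {t \<in> A. g3 t u} = 0" if "u \<in> S" for u
    by (rule zero) (use that d13 in \<open>auto simp: S_def\<close>)
  then have S1: "card {t \<in> A. g1 u t} = b" if "u \<in> S" for u
    using b sub that by fastforce
  have "card {t \<in> A. g1 u t} = 0" if "u \<in> A - S" for u
    by (rule zero) (use that in \<open>auto simp: S_def\<close>)
  then have S3: "card {t \<in> A. g3 t u} = b" if "u \<in> A - S" for u
    using b sub that by fastforce
  have "card {t \<in> A. g3 u t} = 0" if "u \<in> R" for u
    by (rule zero) (use that d23 in \<open>auto simp: R_def\<close>)
  then have R2: "card {t \<in> A. g2 u t} = c" if "u \<in> R" for u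
    using c sub that by fastforce
  have "card {t \<in> A. g2 u t} = 0" if "u \<in> A - R" for u
    by (rule zero) (use that in \<open>auto simp: R_def\<close>)
  then have R3: "card {t \<in> A. g3 u t} = c" if "u \<in> A - R" for u
    using c sub that by fastforce
  \<comment> \<open>The three chosen lines supply an element inside and an element outside each of
    R, S and T.\<close>
  have mem: "b1 \<in> S" "c1 \<in> T" "a2 \<in> R" "c2 \<notin> T" "a3 \<notin> R" "b3 \<notin> S"
    using w d12 d13 d23 by (auto simp: R_def S_def T_def)
  \<comment> \<open>Each constant is the size of a set containing a coordinate of a chosen line:
    \<open>b1\<close> for a, \<open>c1\<close> for b, \<open>c2\<close> for c.\<close>
  have "a > 0" "b > 0" "c > 0"
    using T1[of c1] S1[of b1] R2[of a2] mem w pos[of b1 "\<lambda>t. g1 t c1"] pos[of c1 "\<lambda>t. g1 b1 t"]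
      pos[of c2 "\<lambda>t. g2 a2 t"] by auto
  moreover have "R \<noteq> {}" "S \<noteq> {}" "T \<noteq> {}" "R \<subset> A" "S \<subset> A" "T \<subset> A"
    using mem w sub by blast+
  moreover have "\<forall>v \<in> T. card (D1 \<inter> (S \<times> {v})) = a"
    using col[OF D1_def D1_sub] T1 sub by blast
  moreover have "\<forall>u \<in> S. card (D1 \<inter> ({u} \<times> T)) = b"
    using row[OF D1_def D1_sub] S1 sub by blast
  moreover have "\<forall>v \<in> A - T. card (D2 \<inter> (R \<times> {v})) = a"
    using col[OF D2_def D2_sub] T2 by blast
  moreover have "\<forall>u \<in> R. card (D2 \<inter> ({u} \<times> (A - T))) = c"
    using row[OF D2_def D2_sub] R2 sub by blast
  moreover have "\<forall>v \<in> A - S. card (D3 \<inter> ((A - R) \<times> {v})) = b"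
    using col[OF D3_def D3_sub] S3 by blast
  moreover have "\<forall>u \<in> A - R. card (D3 \<inter> ({u} \<times> (A - S))) = c"
    using row[OF D3_def D3_sub] R3 by blast
  ultimately show ?thesis
    unfolding construction_D_def using D1_sub D2_sub D3_sub C_eq
    by (intro exI[of _ R] exI[of _ S] exI[of _ T] exI[of _ D1] exI[of _ D2] exI[of _ D3]
      exI[of _ a] exI[of _ b] exI[of _ c] conjI) assumption+
qed

theorem theorem4:
  fixes A :: "'a set" and q :: nat and C :: "(nat \<Rightarrow> 'a) set"
  assumes "card A = q" and "q \<ge> 2"
    and "completely_regular_radius_1 A C"
  shows "strong_clique_property A C \<longleftrightarrow> construction_D A C"
proof
  show "construction_D A C" if "strong_clique_property A C"
    using strong_clique_property_imp_construction_D[OF _ assms(3) that] assms(1,2) by simp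
qed (rule construction_D_imp_strong_clique_property)

end
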